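(* Let $\tau$ be an infinite cardinal and let $f:P\to K$ be a (surjective) homeomorphism between closed negligible subsets $P$ and $K$ of the Cantor cube $D^\tau$. Then $f$ can be extended to a homeomorphism of $D^\tau$ onto itself.
   Context: $D=\{0,1\}$ is the two-point discrete space and $D^\tau$ is the product of $\tau$ copies of $D$ with the product topology; its weight is $\tau$. A subset of a topological space $Z$ is called negligible if it does not contain a non-empty intersection of a family of open subsets of $Z$ such that the cardinality of the family is less than the weight of $Z$. *)

theory Defs
  imports "HOL-Analysis.Analysis"
begin

unbundle cardinal_syntax

definition base_of :: "'a topology \<Rightarrow> 'a set set \<Rightarrow> bool" where
  "base_of X B \<longleftrightarrow> openin X = arbitrary union_of (\<lambda>U. U \<in> B)"

text \<open>The weight is the least cardinality of a base, as a cardinal in the sense of the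
  library, i.e. as a well-order relation determined up to \<open>=o\<close>.\<close>

definition weight :: "'a topology \<Rightarrow> 'a set rel" where
  "weight X = (SOME \<kappa>. \<exists>B. base_of X B \<and> \<kappa> = |B| \<and> (\<forall>B'. base_of X B' \<longrightarrow> |B| \<le>o |B'| ))"

lemma weight_attained:
  "\<exists>B. base_of X B \<and> weight X = |B| \<and> (\<forall>B'. base_of X B' \<longrightarrow> |B| \<le>o |B'| )"
proof -
  define R where "R = {|B| | B. base_of X B}"
  have "base_of X {U. openin X U}"
    by (auto simp: base_of_def fun_eq_iff union_of_def arbitrary_def)
  then have "R \<noteq> {}" and "\<forall>r\<in>R. Card_order r"
    unfolding R_def using card_of_Card_order by blast+
  then obtain r where "r \<in> R" "\<forall>r'\<in>R. r \<le>o r'"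
    using exists_minim_Card_order by blast
  then have "\<exists>\<kappa> B. base_of X B \<and> \<kappa> = |B| \<and> (\<forall>B'. base_of X B' \<longrightarrow> |B| \<le>o |B'| )"
    unfolding R_def by blast
  then show ?thesis
    unfolding weight_def by (rule someI_ex)
qed

lemma weight_le: "base_of X B \<Longrightarrow> weight X \<le>o |B|"
  using weight_attained[of X] by auto

text \<open>Intersecting with \<open>topspace X\<close> only matters for the empty family, whose
  intersection in \<open>X\<close> is the whole space.\<close>

definition negligible_in :: "'a topology \<Rightarrow> 'a set \<Rightarrow> bool" where
  "negligible_in X A \<longleftrightarrow>
     (\<nexists>\<U>. (\<forall>U\<in>\<U>. openin X U) \<and> |\<U>| <o weight X \<and>
          topspace X \<inter> \<Inter>\<U> \<noteq> {} \<and> topspace X \<inter> \<Inter>\<U> \<subseteq> A)"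

text \<open>The two-point discrete space is \<^typ>\<open>bool\<close>, and the \<open>\<tau>\<close> copies of it are indexed by
  the field of the cardinal \<open>\<tau>\<close>.\<close>

definition cantor_cube :: "'i rel \<Rightarrow> ('i \<Rightarrow> bool) topology" where
  "cantor_cube \<tau> = product_topology (\<lambda>_. discrete_topology UNIV) (Field \<tau>)"

end

theory Submission
  imports Defs
begin

text \<open>Write \<open>X\<close> for the cube \<open>D\<^sup>T\<close>. If \<open>P\<close> is closed and negligible, every fibre of \<open>X\<close> over fewer than
  \<open>\<tau>\<close> coordinates leaves \<open>P\<close>, so by compactness finitely many further coordinates suffice to avoid
  \<open>P\<close>, by values depending continuously on the given ones. Transfinite recursion splits \<open>T\<close> into
  finite blocks such that \<open>x \<in> P\<close> never equals, on a block, a continuous function of its earlier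
  coordinates. Adding these functions modulo 2 is a triangular homeomorphism of \<open>X\<close>, after which
  no point of \<open>P\<close> vanishes on any block. Each block, padded with infinitely many other coordinates,
  is then recoded so that not vanishing on it becomes vanishing of one single coordinate. This gives a
  homeomorphism \<open>X \<rightarrow> X \<times> X\<close> that moves \<open>P\<close> into the slice \<open>X \<times> {0}\<close>. Two closed sets lying in such
  slices are exchanged by Klee's trick, as maps from closed subsets of \<open>X\<close> to \<open>X\<close> extend to \<open>X\<close>.\<close>

subsection \<open>Cubes\<close>

abbreviation cube :: "'i set \<Rightarrow> ('i \<Rightarrow> bool) topology" where
  "cube T \<equiv> product_topology (\<lambda>_. discrete_topology UNIV) T"

lemma PiE_UNIV_eq_extensional [simp]: "(\<Pi>\<^sub>E i\<in>T. UNIV) = extensional T"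
  by (simp add: PiE_def)

lemma topspace_cube: "topspace (cube T) = extensional T"
  by simp

lemma compact_space_cube: "compact_space (cube T)"
  by (simp add: compact_space_product_topology compact_space_discrete_topology)

lemma Hausdorff_space_cube: "Hausdorff_space (cube T)"
  by (simp add: Hausdorff_space_product_topology)

definition cylinder :: "'i set \<Rightarrow> 'i set \<Rightarrow> ('i \<Rightarrow> bool) \<Rightarrow> ('i \<Rightarrow> bool) set" where
  "cylinder T E x = {z \<in> extensional T. \<forall>i\<in>E. z i = x i}"

lemma mem_cylinder: "z \<in> cylinder T E x \<longleftrightarrow> z \<in> extensional T \<and> (\<forall>i\<in>E. z i = x i)"
  by (simp add: cylinder_def)

lemma openin_cylinder:
  assumes "finite E" "E \<subseteq> T"
  shows "openin (cube T) (cylinder T E x)"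
proof -
  have "cylinder T E x = PiE T (\<lambda>i. if i \<in> E then {x i} else UNIV)"
    using assms(2) by (auto simp: cylinder_def PiE_def Pi_def)
  moreover have "{i \<in> T. (if i \<in> E then {x i} else UNIV) \<noteq> UNIV} \<subseteq> E"
    by auto
  ultimately show ?thesis
    using assms(1) by (auto simp: openin_PiE_gen intro: finite_subset)
qed

lemma openin_cube_cylinder:
  assumes "openin (cube T) U" "x \<in> U"
  obtains E where "finite E" "E \<subseteq> T" "cylinder T E x \<subseteq> U"
proof -
  obtain V where V: "finite {i \<in> T. V i \<noteq> UNIV}" "x \<in> Pi\<^sub>E T V" "Pi\<^sub>E T V \<subseteq> U"
    using assms unfolding openin_product_topology_alt by force
  show thesis
  proof
    show "cylinder T {i \<in> T. V i \<noteq> UNIV} x \<subseteq> U"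
    proof
      fix z assume z: "z \<in> cylinder T {i \<in> T. V i \<noteq> UNIV} x"
      have "z i \<in> V i" if "i \<in> T" for i
        using z V(2) that by (cases "V i = UNIV") (auto simp: PiE_iff mem_cylinder)
      then have "z \<in> Pi\<^sub>E T V"
        using z by (simp add: PiE_iff mem_cylinder)
      then show "z \<in> U"
        using V(3) by (rule subsetD[rotated])
    qed
  qed (use V in auto)
qed

section \<open>Continuous maps between cubes\<close>

lemma continuous_map_into_cube:
  assumes "\<And>x. x \<in> topspace X \<Longrightarrow> f x \<in> extensional T"
    and "\<And>i. i \<in> T \<Longrightarrow> continuous_map X (discrete_topology UNIV) (\<lambda>x. f x i)"
  shows "continuous_map X (cube T) f"
  using assms by (intro continuous_map_coordinatewise_then_product) (auto simp: extensional_def)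

lemma continuous_map_cube_coord:
  assumes "continuous_map X (cube T) f" "i \<in> T"
  shows "continuous_map X (discrete_topology UNIV) (\<lambda>x. f x i)"
  using assms by (simp add: continuous_map_componentwise)

lemma continuous_map_bool_op:
  assumes "continuous_map X (discrete_topology UNIV) p" "continuous_map X (discrete_topology UNIV) q"
  shows "continuous_map X (discrete_topology (UNIV :: bool set)) (\<lambda>x. h (p x) (q x))"
proof -
  have "continuous_map X (prod_topology (discrete_topology UNIV) (discrete_topology UNIV)) (\<lambda>x. (p x, q x))"
    using assms by (rule continuous_map_pairedI)
  then have "continuous_map X (discrete_topology UNIV) ((\<lambda>(a, b). h a b) \<circ> (\<lambda>x. (p x, q x)))"
    by (rule continuous_map_compose) (simp flip: prod_topology_discrete_topology)
  then show ?thesis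
    by (simp add: o_def)
qed

text \<open>Around each point \<open>h\<close> is constant on the cylinder over \<open>J\<close>,
  which is open because \<open>J\<close> is finite; so \<open>h\<close> is locally constant.\<close>

lemma continuous_map_finitely_determined:
  fixes h :: "('i \<Rightarrow> bool) \<Rightarrow> bool"
  assumes "finite J" "J \<subseteq> T"
    and "\<And>x x'. x \<in> extensional T \<Longrightarrow> x' \<in> extensional T \<Longrightarrow> (\<And>i. i \<in> J \<Longrightarrow> x i = x' i) \<Longrightarrow> h x = h x'"
  shows "continuous_map (cube T) (discrete_topology UNIV) h"
proof (clarsimp simp: continuous_map_def)
  fix V
  let ?S = "{x \<in> extensional T. h x \<in> V}"
  show "openin (cube T) ?S"
  proof (subst openin_subopen, rule ballI)
    fix x assume x: "x \<in> ?S"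
    let ?W = "cylinder T J x"
    have "?W \<subseteq> ?S"
    proof
      fix z assume z: "z \<in> ?W"
      have "h z = h x"
        by (rule assms(3)) (use z x in \<open>simp_all add: mem_cylinder\<close>)
      then show "z \<in> ?S"
        using z x by (simp add: mem_cylinder)
    qed
    moreover have "x \<in> ?W"
      using x by (simp add: mem_cylinder)
    ultimately show "\<exists>W. openin (cube T) W \<and> x \<in> W \<and> W \<subseteq> ?S"
      using openin_cylinder[OF assms(1,2)] by blast
  qed
qed

text \<open>A continuous bijection from a compact space onto a Hausdorff space is a homeomorphism,
  so continuity of the inverse never has to be checked for the maps built below.\<close>

lemma homeomorphic_map_cube:
  assumes "continuous_map (cube T) Y f" "Hausdorff_space Y" "bij_betw f (extensional T) (topspace Y)"
  shows "homeomorphic_map (cube T) Y f"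
  using assms
  by (intro continuous_imp_homeomorphic_map)
     (auto simp: compact_space_cube bij_betw_def)

section \<open>Clopen separation and extension of maps\<close>

text \<open>Cylinders over finite sets are clopen and form a base. Compactness covers
  \<open>A\<close> by finitely many of them that miss \<open>B\<close>, and a finite union of clopen
  sets is clopen.\<close>

lemma clopen_separation:
  assumes A: "closedin (cube T) A" and B: "closedin (cube T) B" and "A \<inter> B = {}"
  obtains U where "openin (cube T) U" "closedin (cube T) U" "A \<subseteq> U" "U \<inter> B = {}"
proof -
  have AT: "A \<subseteq> extensional T"
    using closedin_subset[OF A] topspace_cube by metis
  define C where "C = {U. openin (cube T) U \<and> closedin (cube T) U \<and> U \<inter> B = {}}"
  have "\<exists>U\<in>C. a \<in> U" if "a \<in> A" for a
  proof -
    have "openin (cube T) (topspace (cube T) - B)" "a \<in> topspace (cube T) - B"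
      using openin_diff[OF openin_topspace B] that assms(3) AT by auto
    then obtain E where E: "finite E" "E \<subseteq> T"
      and sub: "cylinder T E a \<subseteq> topspace (cube T) - B"
      by (rule openin_cube_cylinder)
    \<comment> \<open>The condition is written as membership in \<open>{True}\<close> so that the
      cylinder appears as the preimage of a closed set under a finitely determined map.\<close>
    have "closedin (cube T) {x \<in> topspace (cube T). (\<forall>i\<in>E. x i = a i) \<in> {True}}"
      by (rule closedin_continuous_map_preimage[where Y = "discrete_topology UNIV"],
          rule continuous_map_finitely_determined[OF E]) auto
    then have "closedin (cube T) (cylinder T E a)"
      by (simp add: cylinder_def)
    then have "cylinder T E a \<in> C"
      using openin_cylinder[OF E] sub unfolding C_def by blast
    then show ?thesis
      using that AT by (intro bexI) (auto simp: mem_cylinder)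
  qed
  then have "A \<subseteq> \<Union>C"
    by blast
  then obtain F where F: "finite F" "F \<subseteq> C" "A \<subseteq> \<Union>F"
    using compactinD[OF closedin_compact_space[OF compact_space_cube A], of C]
    by (metis (no_types, lifting) C_def mem_Collect_eq)
  show thesis
    using F by (intro that[of "\<Union>F"] openin_Union closedin_Union) (auto simp: C_def)
qed

text \<open>The coordinates extend independently of each other. Coordinate \<open>i\<close> of
  \<open>f\<close> divides \<open>P\<close> into two disjoint closed sets, and the indicator of a
  clopen set separating them is the extension.\<close>

lemma extend_into_cube:
  assumes P: "closedin (cube T) P" and f: "continuous_map (subtopology (cube T) P) (cube S) f"
  obtains F where "continuous_map (cube T) (cube S) F" "\<forall>x\<in>P. F x = f x"
proof -
  have PT: "P \<subseteq> topspace (cube T)"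
    using closedin_subset[OF P] .
  have "\<exists>U. openin (cube T) U \<and> closedin (cube T) U \<and> (\<forall>x\<in>P. x \<in> U \<longleftrightarrow> f x i)" if "i \<in> S" for i
  proof -
    have cl: "closedin (cube T) {x \<in> P. f x i \<in> V}" for V
    proof -
      have "closedin (subtopology (cube T) P) {x \<in> topspace (subtopology (cube T) P). f x i \<in> V}"
        using continuous_map_cube_coord[OF f that]
        by (rule closedin_continuous_map_preimage) simp
      moreover have "topspace (subtopology (cube T) P) = P"
        using PT by auto
      ultimately show ?thesis
        using closedin_closed_subtopology[OF P] by (simp only:)
    qed
    have "{x \<in> P. f x i \<in> {True}} \<inter> {x \<in> P. f x i \<in> {False}} = {}"
      by auto
    from clopen_separation[OF cl cl this]
    obtain U where "openin (cube T) U" "closedin (cube T) U"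
      "{x \<in> P. f x i \<in> {True}} \<subseteq> U" "U \<inter> {x \<in> P. f x i \<in> {False}} = {}" .
    then show ?thesis
      by (intro exI[of _ U]) auto
  qed
  then obtain U where U: "\<And>i. i \<in> S \<Longrightarrow> openin (cube T) (U i)" "\<And>i. i \<in> S \<Longrightarrow> closedin (cube T) (U i)"
    "\<And>i x. i \<in> S \<Longrightarrow> x \<in> P \<Longrightarrow> x \<in> U i \<longleftrightarrow> f x i"
    by metis
  show thesis
  proof
    show "continuous_map (cube T) (cube S) (\<lambda>x. \<lambda>i\<in>S. x \<in> U i)"
    proof (rule continuous_map_into_cube)
      fix i assume i: "i \<in> S"
      have "openin (cube T) {x \<in> topspace (cube T). (x \<in> U i) \<in> V}" for V
      proof -
        have "{x \<in> topspace (cube T). (x \<in> U i) \<in> V} =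
              (if True \<in> V then U i else {}) \<union> (if False \<in> V then topspace (cube T) - U i else {})"
          using openin_subset[OF U(1)[OF i]]
          by (auto split: if_splits) (metis (full_types))+
        moreover have "openin (cube T) (if True \<in> V then U i else {})"
          using U(1)[OF i] by simp
        moreover have "openin (cube T) (if False \<in> V then topspace (cube T) - U i else {})"
          using openin_diff[OF openin_topspace U(2)[OF i]] by simp
        ultimately show ?thesis
          by (simp only: openin_Un)
      qed
      then show "continuous_map (cube T) (discrete_topology UNIV) (\<lambda>x. (\<lambda>i\<in>S. x \<in> U i) i)"
        using i by (simp add: continuous_map_def)
    qed auto
    show "\<forall>x\<in>P. (\<lambda>i\<in>S. x \<in> U i) = f x"
    proof
      fix x assume x: "x \<in> P"
      have "f x \<in> extensional S"
        using continuous_map_funspace[OF f] x PT topspace_cube by fastforce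
      then show "(\<lambda>i\<in>S. x \<in> U i) = f x"
        using U(3) x by (auto simp: extensional_def restrict_def fun_eq_iff)
    qed
  qed
qed

section \<open>Triangular homeomorphisms\<close>

text \<open>The inequality is addition modulo 2. Since \<open>v i\<close> reads only coordinates
  below \<open>i\<close>, a point is recovered from its image by recursion along \<open>R\<close>;
  finiteness of \<open>J i\<close> gives continuity.\<close>

lemma triangular_homeomorphic_map:
  fixes v :: "'i \<Rightarrow> ('i \<Rightarrow> bool) \<Rightarrow> bool"
  assumes wf: "wf R" and fin: "\<And>i. i \<in> T \<Longrightarrow> finite (J i)" and sub: "\<And>i. i \<in> T \<Longrightarrow> J i \<subseteq> T"
    and JR: "\<And>i j. i \<in> T \<Longrightarrow> j \<in> J i \<Longrightarrow> (j, i) \<in> R"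
    and det: "\<And>i x x'. i \<in> T \<Longrightarrow> (\<And>j. j \<in> J i \<Longrightarrow> x j = x' j) \<Longrightarrow> v i x = v i x'"
  shows "homeomorphic_map (cube T) (cube T) (\<lambda>x. \<lambda>i\<in>T. x i \<noteq> v i x)" (is "homeomorphic_map _ _ ?t")
proof (rule homeomorphic_map_cube)
  show "continuous_map (cube T) (cube T) ?t"
  proof (rule continuous_map_into_cube)
    fix i assume i: "i \<in> T"
    show "continuous_map (cube T) (discrete_topology UNIV) (\<lambda>x. ?t x i)"
    proof (rule continuous_map_finitely_determined[of "insert i (J i)"])
      fix x x' :: "'i \<Rightarrow> bool" assume "\<And>j. j \<in> insert i (J i) \<Longrightarrow> x j = x' j"
      then show "?t x i = ?t x' i"
        using det[OF i, of x x'] i by simp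
    qed (use i fin sub in auto)
  qed auto
  show "bij_betw ?t (extensional T) (topspace (cube T))"
    unfolding topspace_cube
  proof (rule bij_betw_imageI)
    show "inj_on ?t (extensional T)"
    proof (rule inj_onI)
      fix x y assume x: "x \<in> extensional T" and y: "y \<in> extensional T" and eq: "?t x = ?t y"
      have "i \<in> T \<longrightarrow> x i = y i" for i
        using wf
      proof (induction i rule: wf_induct_rule)
        case (less i)
        show ?case
        proof
          assume i: "i \<in> T"
          then have "x j = y j" if "j \<in> J i" for j
            using less sub JR that by blast
          then have "v i x = v i y"
            using det i by blast
          then show "x i = y i"
            using fun_cong[OF eq, of i] i by auto
        qed
      qed
      then show "x = y"
        using x y by (intro extensionalityI[of x T y]) auto
    qed
    have "z \<in> ?t ` extensional T" if z: "z \<in> extensional T" for z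
    proof -
      \<comment> \<open>The preimage solves \<open>x i = (z i \<noteq> v i x)\<close>, in which the
        right-hand side involves only coordinates already computed.\<close>
      define x where "x = wfrec R (\<lambda>x i. z i \<noteq> v i x)"
      have x: "x i \<longleftrightarrow> z i \<noteq> v i x" if "i \<in> T" for i
      proof -
        have "x i \<longleftrightarrow> z i \<noteq> v i (cut x R i)"
          using wfrec[OF wf, of "\<lambda>x i. z i \<noteq> v i x" i] unfolding x_def by simp
        also have "v i (cut x R i) = v i x"
          using JR that by (intro det) (auto simp: cut_apply)
        finally show ?thesis .
      qed
      \<comment> \<open>The recursion also assigns values outside \<open>T\<close>; cutting them off
        is harmless because \<open>J i\<close> lies in \<open>T\<close>.\<close>
      have "v i (restrict x T) = v i x" if "i \<in> T" for i
        using sub that by (intro det) auto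
      then have "?t (restrict x T) = z"
        using z x by (auto simp: fun_eq_iff extensional_def)
      then show ?thesis
        by (intro image_eqI[of _ _ "restrict x T"]) auto
    qed
    then show "?t ` extensional T = extensional T"
      by auto
  qed
qed (rule Hausdorff_space_cube)


subsection \<open>Avoiding a negligible set\<close>

lemma card_of_finite_ordLess_infinite:
  assumes "finite A" "infinite B"
  shows "|A| <o |B|"
proof (rule ccontr)
  assume "\<not> |A| <o |B|"
  then have "|B| \<le>o |A|"
    by (simp add: not_ordLess_iff_ordLeq card_of_Well_order)
  then show False
    using card_of_ordLeq_finite assms by metis
qed

text \<open>The members of a base that are chosen as neighbourhoods of \<open>0\<close> inside the half cubes
  \<open>z i = 0\<close> determine \<open>i\<close> up to finitely many possibilities.\<close>

lemma ordLeq_weight_cube: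
  assumes "infinite T"
  shows "|T| \<le>o weight (cube T)"
proof -
  obtain B where B: "base_of (cube T) B" "weight (cube T) = |B|"
    using weight_attained by blast
  define p where "p = (\<lambda>i\<in>T. False)"
  have "\<exists>V\<in>B. p \<in> V \<and> V \<subseteq> cylinder T {i} p" if "i \<in> T" for i
  proof -
    have "openin (cube T) (cylinder T {i} p)"
      using that by (intro openin_cylinder) auto
    then have "(arbitrary union_of (\<lambda>U. U \<in> B)) (cylinder T {i} p)"
      using B(1) unfolding base_of_def by simp
    moreover have "p \<in> cylinder T {i} p"
      by (simp add: p_def mem_cylinder)
    ultimately show ?thesis
      unfolding arbitrary_union_of_alt Bex_def by (rule bspec)
  qed
  then obtain V where V: "\<And>i. i \<in> T \<Longrightarrow> V i \<in> B" "\<And>i. i \<in> T \<Longrightarrow> p \<in> V i"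
    "\<And>i. i \<in> T \<Longrightarrow> V i \<subseteq> cylinder T {i} p"
    by metis
  have fin: "finite {i \<in> T. V i = W}" if "W \<in> B" for W
  proof (cases "\<exists>i\<in>T. V i = W")
    case True
    have "openin (cube T) W"
      using B(1) that unfolding base_of_def arbitrary_union_of_alt by auto
    moreover have "p \<in> W"
      using True V(2) by blast
    ultimately obtain E where E: "finite E" "E \<subseteq> T" "cylinder T E p \<subseteq> W"
      by (rule openin_cube_cylinder)
    have "i \<in> E" if "i \<in> T" "V i = W" for i
    proof (rule ccontr)
      assume "i \<notin> E"
      \<comment> \<open>Flipping a coordinate outside \<open>E\<close> stays in the cylinder, hence
        in \<open>W\<close>, but leaves the half cube that contains \<open>V i = W\<close>.\<close>
      then have "p(i := True) \<in> cylinder T E p"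
        using that by (auto simp: p_def extensional_def mem_cylinder)
      then have "(p(i := True)) i = p i"
        using E(3) V(3)[OF that(1)] that(2) by (metis insertI1 mem_cylinder subsetD)
      then show False
        using that by (simp add: p_def)
    qed
    then show ?thesis
      using E(1) by (auto intro: finite_subset)
  next
    case False
    then have "{i \<in> T. V i = W} = {}"
      by blast
    then show ?thesis
      by (metis finite.emptyI)
  qed
  \<comment> \<open>\<open>T\<close> is a union of finite sets indexed by \<open>B\<close>. Hence
    \<open>B\<close> is infinite and the union has at most \<open>|B|\<close> elements.\<close>
  have T: "T = (\<Union>W\<in>B. {i \<in> T. V i = W})"
    using V(1) by blast
  then have "infinite B"
    using assms fin by (metis (no_types, lifting) finite_UN)
  then have "|\<Union>W\<in>B. {i \<in> T. V i = W}| \<le>o |B|"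
    using fin by (intro card_of_UNION_ordLeq_infinite ordLeq_reflexive card_of_Well_order) (auto intro: ordLess_imp_ordLeq card_of_finite_ordLess_infinite)
  then show ?thesis
    using T B(2) by simp
qed

text \<open>A fibre over \<open>A\<close> is the intersection of the open half cubes fixing one
  coordinate of \<open>A\<close> each. There are fewer of them than the weight, so \<open>P\<close>
  cannot contain the fibre.\<close>

lemma negligible_in_cube_fibre:
  assumes "infinite T" "negligible_in (cube T) P" "A \<subseteq> T" "|A| <o |T|" "x \<in> extensional T"
  shows "\<exists>y \<in> extensional T - P. \<forall>i\<in>A. y i = x i"
proof (rule ccontr)
  assume no: "\<not> ?thesis"
  let ?W = "\<lambda>i. cylinder T {i} x"
  have "openin (cube T) (?W i)" if "i \<in> A" for i
    using that assms(3) by (intro openin_cylinder) auto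
  then have "\<forall>U\<in>?W ` A. openin (cube T) U"
    by blast
  moreover have "|?W ` A| <o weight (cube T)"
    using ordLess_ordLeq_trans[OF assms(4) ordLeq_weight_cube[OF assms(1)]]
    by (rule ordLeq_ordLess_trans[OF card_of_image])
  moreover have "x \<in> topspace (cube T) \<inter> \<Inter>(?W ` A)"
    using assms(5) by (simp add: mem_cylinder)
  then have "topspace (cube T) \<inter> \<Inter>(?W ` A) \<noteq> {}"
    by (metis empty_iff)
  moreover have "topspace (cube T) \<inter> \<Inter>(?W ` A) \<subseteq> P"
  proof
    fix y assume "y \<in> topspace (cube T) \<inter> \<Inter>(?W ` A)"
    then have "y \<in> extensional T" "\<forall>i\<in>A. y i = x i"
      by (simp_all add: mem_cylinder)
    then show "y \<in> P"
      using no by blast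
  qed
  ultimately show False
    using assms(2) unfolding negligible_in_def not_ex
    by (elim allE[of _ "?W ` A"]) (simp only: simp_thms)
qed

text \<open>Each fibre contains a point \<open>y\<close> with a finite cylinder, over
  \<open>E y\<close>, that misses \<open>P\<close>. The cylinders over the traces
  \<open>E y \<inter> A\<close> cover the cube; a finite subcover leaves finitely many
  \<open>y\<close> to choose from. \<open>J\<close> collects their coordinates inside
  \<open>A\<close> and \<open>F\<close> those outside.\<close>

lemma finite_avoidance:
  assumes P: "closedin (cube T) P" and "A \<subseteq> T"
    and fibre: "\<And>x. x \<in> extensional T \<Longrightarrow> \<exists>y \<in> extensional T - P. \<forall>i\<in>A. y i = x i"
  obtains F J u where "finite F" "F \<subseteq> T - A" "finite J" "J \<subseteq> A"
    "\<forall>x x'. (\<forall>i\<in>J. x i = x' i) \<longrightarrow> u x = u x'" "\<forall>x\<in>P. \<exists>i\<in>F. x i \<noteq> u x i"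
proof -
  have "\<forall>y\<in>extensional T - P. \<exists>E. finite E \<and> E \<subseteq> T \<and> cylinder T E y \<inter> P = {}"
  proof
    fix y assume that: "y \<in> extensional T - P"
    have "openin (cube T) (topspace (cube T) - P)" "y \<in> topspace (cube T) - P"
      using openin_diff[OF openin_topspace P] that by auto
    then obtain E where "finite E" "E \<subseteq> T"
      "cylinder T E y \<subseteq> topspace (cube T) - P"
      by (rule openin_cube_cylinder)
    moreover from this(3) have "cylinder T E y \<inter> P = {}"
      by blast
    ultimately show "\<exists>E. finite E \<and> E \<subseteq> T \<and> cylinder T E y \<inter> P = {}"
      by (intro exI[of _ E] conjI)
  qed
  then obtain E where E: "\<And>y. y \<in> extensional T - P \<Longrightarrow> finite (E y)"
    "\<And>y. y \<in> extensional T - P \<Longrightarrow> E y \<subseteq> T"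
    "\<And>y. y \<in> extensional T - P \<Longrightarrow> cylinder T (E y) y \<inter> P = {}"
    by metis
  let ?W = "\<lambda>y. cylinder T (E y \<inter> A) y"
  have "openin (cube T) (?W y)" if "y \<in> extensional T - P" for y
    using E(1,2)[OF that] by (intro openin_cylinder) auto
  then have op: "\<forall>U\<in>?W ` (extensional T - P). openin (cube T) U"
    by blast
  have cov: "topspace (cube T) \<subseteq> \<Union>(?W ` (extensional T - P))"
  proof
    fix x assume "x \<in> topspace (cube T)"
    then have x: "x \<in> extensional T"
      by simp
    then obtain y where "y \<in> extensional T - P" "\<forall>i\<in>A. y i = x i"
      using fibre by blast
    then show "x \<in> \<Union>(?W ` (extensional T - P))"
      using x by (auto simp: mem_cylinder)
  qed
  obtain G where G: "finite G" "G \<subseteq> ?W ` (extensional T - P)" "topspace (cube T) \<subseteq> \<Union>G"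
    using compact_space_cube[of T, unfolded compact_space_alt, THEN spec, THEN mp, OF conjI, OF op cov]
    by (elim exE conjE)
  then obtain Y where Y: "finite Y" "Y \<subseteq> extensional T - P" "G = ?W ` Y"
    by (meson finite_subset_image)
  \<comment> \<open>\<open>Q x\<close> reads \<open>x\<close> only on \<open>J\<close>. Points that
    agree there have the same predicate, so \<open>SOME\<close> picks the same \<open>y\<close> for
    them; this makes \<open>u\<close> depend on \<open>J\<close> alone.\<close>
  define Q where "Q x y \<longleftrightarrow> y \<in> Y \<and> (\<forall>i\<in>E y \<inter> A. x i = y i)" for x y
  define u where "u x = (SOME y. Q x y)" for x
  have Q: "Q x (u x)" if x: "x \<in> extensional T" for x
  proof -
    obtain y where "y \<in> Y" "x \<in> cylinder T (E y \<inter> A) y"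
      using x G(3) Y(3) by auto
    then have "Q x y"
      unfolding Q_def mem_cylinder by (elim conjE) (intro conjI)
    then have "\<exists>y. Q x y"
      by blast
    then show ?thesis
      unfolding u_def by (rule someI_ex)
  qed
  show thesis
  proof
    show "finite ((\<Union>y\<in>Y. E y) - A)" "finite ((\<Union>y\<in>Y. E y) \<inter> A)"
      using Y(1,2) E(1) by auto
    show "(\<Union>y\<in>Y. E y) - A \<subseteq> T - A"
      using Y(2) E(2) by blast
    have "u x = u x'" if "\<forall>i\<in>(\<Union>y\<in>Y. E y) \<inter> A. x i = x' i" for x x'
    proof -
      have "Q x y = Q x' y" for y
        using that unfolding Q_def by (metis IntD1 IntD2 IntI UN_I)
      then show ?thesis
        unfolding u_def by presburger
    qed
    then show "\<forall>x x'. (\<forall>i\<in>(\<Union>y\<in>Y. E y) \<inter> A. x i = x' i) \<longrightarrow> u x = u x'"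
      by blast
    show "\<forall>x\<in>P. \<exists>i\<in>(\<Union>y\<in>Y. E y) - A. x i \<noteq> u x i"
    proof
      fix x assume xP: "x \<in> P"
      then have x: "x \<in> extensional T"
        using closedin_subset[OF P] by auto
      then have Qx: "Q x (u x)"
        by (rule Q)
      then have ux: "u x \<in> Y" "u x \<in> extensional T - P"
        using Y(2) unfolding Q_def by blast+
      \<comment> \<open>This cylinder misses \<open>P\<close>, so \<open>x\<close> differs from
        \<open>u x\<close> somewhere on \<open>E (u x)\<close>. By \<open>Q\<close> they agree on
        the part inside \<open>A\<close>, so the difference lies in \<open>F\<close>.\<close>
      have "x \<notin> cylinder T (E (u x)) (u x)"
        using E(3)[OF ux(2)] xP by blast
      then obtain i where "i \<in> E (u x)" "x i \<noteq> u x i"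
        using x by (auto simp: mem_cylinder)
      moreover from this have "i \<notin> A"
        using Qx unfolding Q_def by blast
      ultimately show "\<exists>i\<in>(\<Union>y\<in>Y. E y) - A. x i \<noteq> u x i"
        using ux(1) by blast
    qed
  qed simp
qed

section \<open>Transfinite construction of finite blocks\<close>

text \<open>A proper initial segment of a cardinal has smaller cardinality. Replacing its elements
  by finite sets yields a finite set or does not raise the cardinality, so the coordinates used
  before stage \<open>a\<close> stay few enough.\<close>

lemma card_of_UNION_finite_underS:
  assumes r: "Cinfinite r" and a: "a \<in> Field r" and fin: "\<And>b. b \<in> underS r a \<Longrightarrow> finite (F b)"
  shows "|\<Union>b\<in>underS r a. F b| <o |Field r|"
proof (cases "finite (underS r a)")
  case True
  then have "finite (\<Union>b\<in>underS r a. F b)"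
    using fin by blast
  then show ?thesis
    using r by (simp add: cinfinite_def card_of_finite_ordLess_infinite)
next
  case False
  then have "|\<Union>b\<in>underS r a. F b| \<le>o |underS r a|"
    using fin by (intro card_of_UNION_ordLeq_infinite ordLeq_reflexive card_of_Well_order)
      (auto intro: ordLess_imp_ordLeq card_of_finite_ordLess_infinite)
  also have "|underS r a| <o |Field r|"
    using card_of_underS[of r a] r a card_of_Field_ordIso
    by (metis ordIso_symmetric ordLess_ordIso_trans)
  finally show ?thesis .
qed

lemma block_decomposition:
  fixes r :: "'i rel"
  assumes r: "Cinfinite r" and P: "closedin (cube (Field r)) P" "negligible_in (cube (Field r)) P"
  obtains F J u where
    "\<forall>a\<in>Field r. finite (F a) \<and> F a \<noteq> {}"
    "disjoint_family_on F (Field r)" "(\<Union>a\<in>Field r. F a) = Field r"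
    "\<forall>a\<in>Field r. finite (J a) \<and> J a \<subseteq> (\<Union>b\<in>underS r a. F b)"
    "\<forall>a\<in>Field r. \<forall>x x'. (\<forall>i\<in>J a. x i = x' i) \<longrightarrow> u a x = u a x'"
    "\<forall>a\<in>Field r. \<forall>x\<in>P. \<exists>i\<in>F a. x i \<noteq> u a x i"
proof -
  let ?T = "Field r"
  have inf: "infinite ?T"
    using r by (simp add: cinfinite_def)
  have wo: "Well_order r"
    using r by (simp add: card_order_on_well_order_on)
  define R where "R A F J u \<longleftrightarrow> finite F \<and> F \<subseteq> ?T - A \<and> F \<noteq> {} \<and> finite J \<and> J \<subseteq> A \<and>
    (\<forall>x x'. (\<forall>i\<in>J. x i = x' i) \<longrightarrow> u x = u x') \<and> (\<forall>x\<in>P. \<exists>i\<in>F. x i \<noteq> u x i)"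
    for A F J and u :: "('i \<Rightarrow> bool) \<Rightarrow> 'i \<Rightarrow> bool"
  have "\<exists>F J u. R A F J u"
    if A: "A \<subseteq> ?T" "|A| <o |?T|" for A
  proof -
    obtain F J u where *: "finite F" "F \<subseteq> ?T - A" "finite J" "J \<subseteq> A"
      "\<forall>x x'. (\<forall>i\<in>J. x i = x' i) \<longrightarrow> u x = u x'" "\<forall>x\<in>P. \<exists>i\<in>F. x i \<noteq> u x i"
      by (rule finite_avoidance[OF P(1) A(1) negligible_in_cube_fibre[OF inf P(2) A]])
    \<comment> \<open>For empty \<open>P\<close> the set \<open>F\<close> may be empty; a fresh
      coordinate \<open>i\<close> is added so that every block is nonempty.\<close>
    have "\<not> ?T \<subseteq> A"
      using A(2) by (metis card_of_mono1 not_ordLess_ordLeq)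
    then obtain i where "i \<in> ?T - A"
      by blast
    show ?thesis
      unfolding R_def
    proof (intro exI conjI allI impI ballI)
      show "finite (insert i F)" "insert i F \<subseteq> ?T - A" "insert i F \<noteq> {}" "finite J" "J \<subseteq> A"
        using * \<open>i \<in> ?T - A\<close> by auto
      show "u x = u x'" if "\<forall>i\<in>J. x i = x' i" for x x'
        using *(5)[rule_format, of x x'] that by blast
      show "\<exists>i\<in>insert i F. x i \<noteq> u x i" if "x \<in> P" for x
        using *(6) that by blast
    qed
  qed
  then obtain \<Phi> J u where R: "\<And>A. A \<subseteq> ?T \<Longrightarrow> |A| <o |?T| \<Longrightarrow> R A (\<Phi> A) (J A) (u A)"
    by metis
  have \<Phi>: "finite (\<Phi> A) \<and> \<Phi> A \<subseteq> ?T - A \<and> \<Phi> A \<noteq> {}"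
    and J: "finite (J A) \<and> J A \<subseteq> A"
    and u: "\<forall>x x'. (\<forall>i\<in>J A. x i = x' i) \<longrightarrow> u A x = u A x'"
    and avoid: "\<forall>x\<in>P. \<exists>i\<in>\<Phi> A. x i \<noteq> u A x i"
    if "A \<subseteq> ?T" "|A| <o |?T|" for A
    using R[OF that] unfolding R_def by - (elim conjE; (intro conjI)?; assumption)+
  have wf: "wf (r - Id)"
    using wo unfolding well_order_on_def by blast
  \<comment> \<open>Stage \<open>a\<close> also takes in the coordinate \<open>a\<close> itself
    unless it was used before. This makes the blocks exhaust the index set.\<close>
  define H where "H F a = (let A = \<Union>b\<in>underS r a. F b in \<Phi> A \<union> ({a} - A))" for F a
  define F where "F = wfrec (r - Id) H"
  define A where "A a = (\<Union>b\<in>underS r a. F b)" for a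
  have F: "F a = \<Phi> (A a) \<union> ({a} - A a)" for a
  proof -
    have "F a = H (cut F (r - Id) a) a"
      unfolding F_def by (rule wfrec[OF wf])
    also have "(\<Union>b\<in>underS r a. cut F (r - Id) a b) = A a"
      unfolding A_def by (intro SUP_cong) (auto simp: cut_apply underS_def)
    then have "H (cut F (r - Id) a) a = \<Phi> (A a) \<union> ({a} - A a)"
      unfolding H_def Let_def by simp
    finally show ?thesis .
  qed
  \<comment> \<open>The bound on \<open>A a\<close> and the finiteness of the blocks depend on each
    other: earlier blocks are finite by the bound at their own stages, and this yields the bound at
    \<open>a\<close>.\<close>
  have A: "A a \<subseteq> ?T \<and> |A a| <o |?T|" if "a \<in> ?T" for a
    using wf that
  proof (induction a rule: wf_induct_rule)
    case (less a)
    have b: "finite (F b) \<and> F b \<subseteq> ?T" if "b \<in> underS r a" for b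
    proof -
      have "(b, a) \<in> r - Id" "b \<in> ?T"
        using that by (auto simp: underS_def Field_def)
      then have "A b \<subseteq> ?T" "|A b| <o |?T|"
        using less.IH by auto
      then show ?thesis
        using \<Phi>[of "A b"] \<open>b \<in> ?T\<close> unfolding F[of b] by auto
    qed
    then show ?case
      using card_of_UNION_finite_underS[OF r less.prems, of F] unfolding A_def by auto
  qed
  have disj: "F a \<inter> A a = {}" if "a \<in> ?T" for a
    using \<Phi> A that unfolding F[of a] by blast
  show thesis
  proof
    have "finite (F a) \<and> F a \<noteq> {}" if "a \<in> ?T" for a
      using \<Phi>[of "A a"] A[OF that] unfolding F[of a] by auto
    then show "\<forall>a\<in>?T. finite (F a) \<and> F a \<noteq> {}"
      by (rule ballI)
    show "disjoint_family_on F ?T"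
      unfolding disjoint_family_on_def
    proof (intro ballI impI)
      fix a b assume ab: "a \<in> ?T" "b \<in> ?T" "a \<noteq> b"
      then have "a \<in> underS r b \<or> b \<in> underS r a"
        using wo unfolding well_order_on_def linear_order_on_def total_on_def underS_def by auto
      then show "F a \<inter> F b = {}"
        using disj[OF ab(1)] disj[OF ab(2)] unfolding A_def by blast
    qed
    show "(\<Union>a\<in>?T. F a) = ?T"
    proof
      show "(\<Union>a\<in>?T. F a) \<subseteq> ?T"
        using \<Phi> A unfolding F by blast
      show "?T \<subseteq> (\<Union>a\<in>?T. F a)"
      proof
        fix a assume a: "a \<in> ?T"
        have "a \<in> F a \<union> A a"
          unfolding F[of a] by blast
        then show "a \<in> (\<Union>a\<in>?T. F a)"
          using a unfolding A_def by (auto simp: underS_def Field_def)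
      qed
    qed
    show "\<forall>a\<in>?T. finite (J (A a)) \<and> J (A a) \<subseteq> (\<Union>b\<in>underS r a. F b)"
      using J A unfolding A_def by blast
    show "\<forall>a\<in>?T. \<forall>x x'. (\<forall>i\<in>J (A a). x i = x' i) \<longrightarrow> u (A a) x = u (A a) x'"
      by (intro ballI u) (use A in blast)+
    show "\<forall>a\<in>?T. \<forall>x\<in>P. \<exists>i\<in>F a. x i \<noteq> u (A a) x i"
    proof (intro ballI)
      fix a x assume a: "a \<in> ?T" and x: "x \<in> P"
      have "\<exists>i\<in>\<Phi> (A a). x i \<noteq> u (A a) x i"
        using avoid[OF conjunct1[OF A[OF a]] conjunct2[OF A[OF a]]] x by (rule bspec)
      then show "\<exists>i\<in>F a. x i \<noteq> u (A a) x i"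
        unfolding F[of a] by blast
    qed
  qed
qed

subsection \<open>Moving a negligible set into a slice\<close>

lemma enumerate_with_initial_segment:
  assumes F: "finite F" "F \<noteq> {}" "F \<subseteq> G" and G: "countable G" "infinite G"
  obtains c :: "nat \<Rightarrow> 'a" and m where "bij_betw c UNIV G" "c ` {..m} = F"
proof -
  let ?N = "card F"
  have N: "?N > 0"
    using F by (simp add: card_gt_0_iff)
  obtain g where g: "bij_betw g {0..<?N} F"
    using ex_bij_betw_nat_finite[OF F(1)] by blast
  have "infinite (G - F)" "countable (G - F)"
    using F(1) G by auto
  then obtain h :: "nat \<Rightarrow> 'a" where h: "bij_betw h UNIV (G - F)"
    using bij_betw_from_nat_into by blast
  define c where "c n = (if n < ?N then g n else h (n - ?N))" for n
  have c1: "bij_betw c {..<?N} F"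
    using g by (subst bij_betw_cong[of _ c g]) (auto simp: c_def atLeast0LessThan)
  have "bij_betw (\<lambda>n. n - ?N) {?N..} UNIV"
    by (rule bij_betw_byWitness[where f' = "\<lambda>n. n + ?N"]) auto
  then have "bij_betw (h \<circ> (\<lambda>n. n - ?N)) {?N..} (G - F)"
    using h by (rule bij_betw_trans)
  then have c2: "bij_betw c {?N..} (G - F)"
    by (subst bij_betw_cong[of _ c "h \<circ> (\<lambda>n. n - ?N)"]) (auto simp: c_def)
  have "bij_betw c ({..<?N} \<union> {?N..}) (F \<union> (G - F))"
    using c1 c2 by (rule bij_betw_combine) auto
  moreover have "{..<?N} \<union> {?N..} = UNIV" "F \<union> (G - F) = G"
    using F(3) by auto
  ultimately have "bij_betw c UNIV G"
    by simp
  \<comment> \<open>The initial segment \<open>{..m}\<close> includes \<open>m\<close>, so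
    \<open>m\<close> is \<open>card F - 1\<close>; this is correct because \<open>F\<close> is
    nonempty.\<close>
  moreover have "{..?N - 1} = {..<?N}"
    using N by auto
  then have "c ` {..?N - 1} = F"
    using c1 by (simp add: bij_betw_def)
  ultimately show thesis
    by (rule that)
qed

text \<open>Recoding a block needs an infinite sequence of digits. A bijection of
  \<open>T \<times> UNIV\<close> with \<open>T\<close> therefore gathers the blocks into countably
  infinite groups indexed by \<open>T\<close>. Block \<open>e (t, 0)\<close> heads group
  \<open>t\<close> and is the one that gets tested; the others are padding.\<close>

lemma regroup_blocks:
  fixes T :: "'i set"
  assumes inf: "infinite T" and F: "\<And>a. a \<in> T \<Longrightarrow> finite (F a) \<and> F a \<noteq> {}"
    and disj: "disjoint_family_on F T" and un: "(\<Union>a\<in>T. F a) = T"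
  obtains c :: "'i \<Rightarrow> nat \<Rightarrow> 'i" and m where
    "bij_betw (\<lambda>(t, n). c t n) (T \<times> UNIV) T" "\<And>t. t \<in> T \<Longrightarrow> \<exists>a\<in>T. F a = c t ` {..m t}"
proof -
  obtain e where e: "bij_betw e (T \<times> (UNIV :: nat set)) T"
    using card_of_Times_infinite_simps(1)[of T "UNIV :: nat set"] inf infinite_iff_card_of_nat card_of_ordIso
    by (metis UNIV_not_empty)
  have eT: "e (t, n) \<in> T" if "t \<in> T" for t n
    using e that by (auto simp: bij_betw_def)
  have e_inj: "t = t' \<and> n = n'" if "e (t, n) = e (t', n')" "t \<in> T" "t' \<in> T" for t t' n n'
    using bij_betw_imp_inj_on[OF e] that by (auto dest: inj_onD)
  have F_disj: "a = b" if "i \<in> F a" "i \<in> F b" "a \<in> T" "b \<in> T" for a b i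
    using disj that unfolding disjoint_family_on_def by blast
  define G where "G t = (\<Union>n. F (e (t, n)))" for t
  have "\<exists>c m. bij_betw c (UNIV :: nat set) (G t) \<and> c ` {..m} = F (e (t, 0))" if t: "t \<in> T" for t
  proof -
    have "inj (\<lambda>n. F (e (t, n)))"
    proof (rule injI)
      fix n n' assume "F (e (t, n)) = F (e (t, n'))"
      then have "e (t, n) = e (t, n')"
        using F[OF eT[OF t, of n]] F_disj eT[OF t] by blast
      then show "n = n'"
        using e_inj t by blast
    qed
    then have "infinite (range (\<lambda>n. F (e (t, n))))"
      using finite_imageD by blast
    then have "infinite (G t)"
      unfolding G_def using finite_UnionD by blast
    moreover have "countable (G t)"
      unfolding G_def using F eT[OF t] by (auto intro: countable_finite)
    ultimately show ?thesis
      using enumerate_with_initial_segment[of "F (e (t, 0))" "G t"] F[OF eT[OF t, of 0]]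
      unfolding G_def by blast
  qed
  then obtain c m where c: "\<And>t. t \<in> T \<Longrightarrow> bij_betw (c t) (UNIV :: nat set) (G t)"
    and m: "\<And>t. t \<in> T \<Longrightarrow> c t ` {..m t} = F (e (t, 0))"
    by metis
  have c_mem: "c t n \<in> G t" if "t \<in> T" for t n
    using c[OF that] by (auto simp: bij_betw_def)
  have G_disj: "t = t'" if "i \<in> G t" "i \<in> G t'" "t \<in> T" "t' \<in> T" for t t' i
    using that F_disj eT e_inj unfolding G_def by blast
  have "bij_betw (\<lambda>(t, n). c t n) (T \<times> UNIV) T"
  proof (rule bij_betw_imageI)
    show "inj_on (\<lambda>(t, n). c t n) (T \<times> UNIV)"
    proof (rule inj_onI, clarify)
      fix t n t' n' assume *: "t \<in> T" "t' \<in> T" "c t n = c t' n'"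
      then have "t = t'"
        using G_disj c_mem by metis
      then show "t = t' \<and> n = n'"
        using * bij_betw_imp_inj_on[OF c[OF *(1)]] by (auto dest: injD)
    qed
    show "(\<lambda>(t, n). c t n) ` (T \<times> UNIV) = T"
    proof
      have "G t \<subseteq> T" if "t \<in> T" for t
        using un eT[OF that] unfolding G_def by blast
      then show "(\<lambda>(t, n). c t n) ` (T \<times> UNIV) \<subseteq> T"
        using c_mem by auto
      show "T \<subseteq> (\<lambda>(t, n). c t n) ` (T \<times> UNIV)"
      proof
        fix i assume "i \<in> T"
        then obtain a where a: "a \<in> T" "i \<in> F a"
          using un by blast
        have "a \<in> e ` (T \<times> UNIV)"
          using bij_betw_imp_surj_on[OF e] a(1) by (rule ssubst)
        then obtain t n where t: "t \<in> T" "a = e (t, n)"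
          by blast
        then have "i \<in> G t"
          using a unfolding G_def by blast
        then obtain k where "i = c t k"
          using bij_betw_imp_surj_on[OF c[OF t(1)]] by auto
        then show "i \<in> (\<lambda>(t, n). c t n) ` (T \<times> UNIV)"
          using t(1) by (intro image_eqI[of _ _ "(t, k)"]) auto
      qed
    qed
  qed
  moreover have "\<exists>a\<in>T. F a = c t ` {..m t}" if "t \<in> T" for t
    using m[OF that] eT[OF that] by blast
  ultimately show thesis
    by (rule that)
qed

text \<open>A bijection between complete binary prefix codes, in which \<open>0\<^bsup>m+1\<^esup>\<close> becomes \<open>1\<close>, \<open>0\<^bsup>m\<^esup>1\<close> becomes
  \<open>00\<^bsup>m\<^esup>\<close>, and \<open>0\<^bsup>i\<^esup>1\<close> becomes \<open>00\<^bsup>i\<^esup>1\<close> for \<open>i < m\<close>. The first digit is split off as a separate component.\<close>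

definition peel :: "nat \<Rightarrow> (nat \<Rightarrow> bool) \<Rightarrow> bool \<times> (nat \<Rightarrow> bool)" where
  "peel m s = (if \<forall>i\<le>m. \<not> s i then (True, \<lambda>n. s (n + Suc m))
     else (False, if \<forall>i<m. \<not> s i then (\<lambda>n. n \<ge> m \<and> s (Suc n)) else s))"

definition unpeel :: "nat \<Rightarrow> bool \<times> (nat \<Rightarrow> bool) \<Rightarrow> nat \<Rightarrow> bool" where
  "unpeel m = (\<lambda>(b, s). if b then (\<lambda>n. n > m \<and> s (n - Suc m))
     else if \<forall>i<m. \<not> s i then (\<lambda>n. n = m \<or> n > m \<and> s (n - 1)) else s)"

lemma unpeel_peel: "unpeel m (peel m s) = s"
proof (cases "\<forall>i\<le>m. \<not> s i")
  case True
  then have "(n > m \<and> s (n - Suc m + Suc m)) = s n" for n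
    by (cases "n > m") auto
  then show ?thesis
    using True by (simp add: peel_def unpeel_def)
next
  case no: False
  show ?thesis
  proof (cases "\<forall>i<m. \<not> s i")
    case True
    then have "s m"
      using no by (metis le_neq_implies_less)
    have "unpeel m (False, \<lambda>n. m \<le> n \<and> s (Suc n)) n = s n" for n
    proof (cases n m rule: linorder_cases)
      case greater
      then show ?thesis
        by (cases n) (auto simp: unpeel_def)
    qed (use True \<open>s m\<close> in \<open>auto simp: unpeel_def\<close>)
    moreover have "peel m s = (False, \<lambda>n. m \<le> n \<and> s (Suc n))"
      using True no by (simp add: peel_def)
    ultimately show ?thesis
      by (simp add: fun_eq_iff)
  next
    case False
    then show ?thesis
      using no by (auto simp: peel_def unpeel_def)
  qed
qed

lemma peel_unpeel: "peel m (unpeel m p) = p"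
proof (cases p)
  case (Pair b s)
  consider "b" | "\<not> b" "\<forall>i<m. \<not> s i" | "\<not> b" "\<not> (\<forall>i<m. \<not> s i)"
    by blast
  then show ?thesis
  proof cases
    case 1
    then show ?thesis
      by (simp add: Pair peel_def unpeel_def)
  next
    case 2
    then have "(m \<le> n \<and> (Suc n = m \<or> m < Suc n \<and> s n)) = s n" for n
      by (cases "m \<le> n") auto
    moreover have "unpeel m p = (\<lambda>n. n = m \<or> m < n \<and> s (n - 1))"
      using 2 by (simp add: Pair unpeel_def)
    then have "peel m (unpeel m p) = (False, \<lambda>n. m \<le> n \<and> (Suc n = m \<or> m < Suc n \<and> s n))"
      by (auto simp: peel_def)
    ultimately show ?thesis
      using 2 Pair by simp
  next
    case 3
    then have "unpeel m p = s"
      by (auto simp: Pair unpeel_def)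
    moreover have "peel m s = (False, s)"
      using 3 less_imp_le by (auto simp: peel_def)
    ultimately show ?thesis
      using 3 Pair by simp
  qed
qed

text \<open>This provides continuity: an output digit reads finitely many input digits. The bound
  \<open>n + Suc m\<close> covers the longest shift as well as the tests on the first
  \<open>m + 1\<close> digits.\<close>

lemma peel_cong:
  assumes "\<And>i. i \<le> n + Suc m \<Longrightarrow> s i = s' i"
  shows "fst (peel m s) = fst (peel m s')" "snd (peel m s) n = snd (peel m s') n"
proof -
  have "(\<forall>i\<le>m. \<not> s i) = (\<forall>i\<le>m. \<not> s' i)" "(\<forall>i<m. \<not> s i) = (\<forall>i<m. \<not> s' i)"
    "s (n + Suc m) = s' (n + Suc m)" "s (Suc n) = s' (Suc n)" "s n = s' n"
    using assms by auto
  then show "fst (peel m s) = fst (peel m s')" "snd (peel m s) n = snd (peel m s') n"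
    unfolding peel_def by auto
qed

section \<open>Splitting the cube by recoding all groups\<close>

text \<open>\<open>peel\<close> acts on all groups at once. The split-off digits, one for each
  group, form the second factor, and the remaining digits are relabelled by \<open>c\<close> to form
  the first. A nonzero entry in the head block of a group makes its split-off digit
  \<open>False\<close>.\<close>

lemma cube_split:
  fixes T :: "'i set"
  assumes "infinite T" "\<And>a. a \<in> T \<Longrightarrow> finite (F a) \<and> F a \<noteq> {}"
    "disjoint_family_on F T" "(\<Union>a\<in>T. F a) = T"
  obtains \<Psi> where "homeomorphic_map (cube T) (prod_topology (cube T) (cube T)) \<Psi>"
    "\<And>x. (\<forall>a\<in>T. \<exists>i\<in>F a. x i) \<Longrightarrow> snd (\<Psi> x) = (\<lambda>i\<in>T. False)"
proof -
  obtain c m where c: "bij_betw (\<lambda>(t, n). c t n) (T \<times> (UNIV :: nat set)) T"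
    and m: "\<And>t. t \<in> T \<Longrightarrow> \<exists>a\<in>T. F a = c t ` {..m t}"
    using regroup_blocks[OF assms] by blast
  have cT: "c t n \<in> T" if "t \<in> T" for t n
    using bij_betw_imp_surj_on[OF c] that by auto
  \<comment> \<open>Inverting \<open>c\<close> gives each coordinate \<open>i\<close> an address:
    position \<open>k i\<close> in group \<open>a i\<close>.\<close>
  define q where "q = inv_into (T \<times> UNIV) (\<lambda>(t, n). c t n)"
  define a where "a i = fst (q i)" for i
  define k where "k i = snd (q i)" for i
  have q1: "a (c t n) = t" "k (c t n) = n" if "t \<in> T" for t n
    using inv_into_f_f[OF bij_betw_imp_inj_on[OF c], of "(t, n)"] that
    by (simp_all add: a_def k_def q_def)
  have q2: "a i \<in> T" "c (a i) (k i) = i" if "i \<in> T" for i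
  proof -
    have "i \<in> (\<lambda>(t, n). c t n) ` (T \<times> UNIV)"
      using bij_betw_imp_surj_on[OF c] that by simp
    from inv_into_into[OF this] f_inv_into_f[OF this] show "a i \<in> T" "c (a i) (k i) = i"
      by (auto simp: a_def k_def q_def split: prod.splits)
  qed
  define p where "p x t = peel (m t) (\<lambda>n. x (c t n))" for x t
  define \<Psi> where "\<Psi> x = (\<lambda>i\<in>T. snd (p x (a i)) (k i), \<lambda>t\<in>T. fst (p x t))" for x
  define \<Phi> where "\<Phi> yz = (\<lambda>i\<in>T. unpeel (m (a i)) (snd yz (a i), \<lambda>n. fst yz (c (a i) n)) (k i))" for yz
  have p_cong: "fst (p x t) = fst (p x' t)" "snd (p x t) n = snd (p x' t) n"
    if "\<And>i. i \<in> c t ` {..n + Suc (m t)} \<Longrightarrow> x i = x' i" for x x' t n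
    unfolding p_def by (rule peel_cong(1)[of n] peel_cong(2); use that in auto)+
  have "homeomorphic_map (cube T) (prod_topology (cube T) (cube T)) \<Psi>"
  proof (rule homeomorphic_map_cube)
    have "continuous_map (cube T) (cube T) (\<lambda>x. \<lambda>i\<in>T. snd (p x (a i)) (k i))"
    proof (rule continuous_map_into_cube)
      fix i assume i: "i \<in> T"
      let ?J = "c (a i) ` {..k i + Suc (m (a i))}"
      have "continuous_map (cube T) (discrete_topology UNIV) (\<lambda>x. snd (p x (a i)) (k i))"
      proof (rule continuous_map_finitely_determined)
        show "finite ?J" "?J \<subseteq> T"
          using cT q2(1)[OF i] by auto
      qed (rule p_cong(2))
      then show "continuous_map (cube T) (discrete_topology UNIV) (\<lambda>x. (\<lambda>i\<in>T. snd (p x (a i)) (k i)) i)"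
        using i by simp
    qed auto
    moreover have "continuous_map (cube T) (cube T) (\<lambda>x. \<lambda>t\<in>T. fst (p x t))"
    proof (rule continuous_map_into_cube)
      fix t assume t: "t \<in> T"
      \<comment> \<open>The summand \<open>0\<close> presents the set as the case
        \<open>n = 0\<close> of \<open>p_cong\<close>.\<close>
      let ?J = "c t ` {..0 + Suc (m t)}"
      have "continuous_map (cube T) (discrete_topology UNIV) (\<lambda>x. fst (p x t))"
      proof (rule continuous_map_finitely_determined)
        show "finite ?J" "?J \<subseteq> T"
          using cT t by auto
      qed (rule p_cong(1))
      then show "continuous_map (cube T) (discrete_topology UNIV) (\<lambda>x. (\<lambda>t\<in>T. fst (p x t)) t)"
        using t by simp
    qed auto
    ultimately show "continuous_map (cube T) (prod_topology (cube T) (cube T)) \<Psi>"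
      unfolding \<Psi>_def by (rule continuous_map_pairedI)
    show "Hausdorff_space (prod_topology (cube T) (cube T))"
      by (simp add: Hausdorff_space_prod_topology Hausdorff_space_cube)
    have "\<Phi> (\<Psi> x) = x" if x: "x \<in> extensional T" for x
    proof (rule extensionalityI[OF _ x])
      fix i assume i: "i \<in> T"
      have "(\<lambda>n. fst (\<Psi> x) (c (a i) n)) = snd (p x (a i))"
        using i q2(1) q1 cT by (simp add: \<Psi>_def)
      then have "\<Phi> (\<Psi> x) i = unpeel (m (a i)) (p x (a i)) (k i)"
        using i q2(1) by (simp add: \<Phi>_def) (simp add: \<Psi>_def)
      then show "\<Phi> (\<Psi> x) i = x i"
        using i q2(2) by (simp add: p_def unpeel_peel)
    qed (simp add: \<Phi>_def)
    moreover have "\<Psi> (\<Phi> yz) = yz" if yz: "yz \<in> extensional T \<times> extensional T" for yz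
    proof -
      have p: "p (\<Phi> yz) t = (snd yz t, \<lambda>n. fst yz (c t n))" if "t \<in> T" for t
      proof -
        have "(\<lambda>n. \<Phi> yz (c t n)) = unpeel (m t) (snd yz t, \<lambda>n. fst yz (c t n))"
          using that q1 cT by (simp add: \<Phi>_def)
        then show ?thesis
          unfolding p_def by (simp add: peel_unpeel)
      qed
      have "fst (\<Psi> (\<Phi> yz)) = fst yz"
        using yz by (intro extensionalityI[of _ T]) (auto simp: \<Psi>_def p q2)
      moreover have "snd (\<Psi> (\<Phi> yz)) = snd yz"
        using yz by (intro extensionalityI[of _ T]) (auto simp: \<Psi>_def p)
      ultimately show ?thesis
        by (rule prod_eqI)
    qed
    ultimately show "bij_betw \<Psi> (extensional T) (topspace (prod_topology (cube T) (cube T)))"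
      by (intro bij_betw_byWitness[where f' = \<Phi>]) (auto simp: \<Psi>_def \<Phi>_def)
  qed
  moreover have "snd (\<Psi> x) = (\<lambda>i\<in>T. False)" if x: "\<forall>a\<in>T. \<exists>i\<in>F a. x i" for x
  proof -
    have "\<not> fst (p x t)" if t: "t \<in> T" for t
    proof -
      obtain b where "b \<in> T" "F b = c t ` {..m t}"
        using m[OF t] by blast
      then have "\<exists>i\<in>c t ` {..m t}. x i"
        using x by metis
      then show ?thesis
        unfolding p_def peel_def by auto
    qed
    then show ?thesis
      by (auto simp: \<Psi>_def fun_eq_iff)
  qed
  ultimately show thesis
    by (rule that)
qed

text \<open>Adding \<open>u (blk i) x i\<close> modulo 2 turns a difference between \<open>x\<close>
  and \<open>u a x\<close> on block \<open>a\<close> into a nonzero entry there. Points of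
  \<open>P\<close> thus become nonzero on every block, as \<open>cube_split\<close>
  requires.\<close>

lemma negligible_into_slice:
  fixes r :: "'i rel"
  assumes r: "Cinfinite r" and P: "closedin (cube (Field r)) P" "negligible_in (cube (Field r)) P"
  obtains \<Psi> where
    "homeomorphic_map (cube (Field r)) (prod_topology (cube (Field r)) (cube (Field r))) \<Psi>"
    "\<And>x. x \<in> P \<Longrightarrow> snd (\<Psi> x) = (\<lambda>i\<in>Field r. False)"
proof -
  let ?T = "Field r"
  obtain F J u where F0: "\<forall>a\<in>?T. finite (F a) \<and> F a \<noteq> {}"
    and disj: "disjoint_family_on F ?T" and un: "(\<Union>a\<in>?T. F a) = ?T"
    and J0: "\<forall>a\<in>?T. finite (J a) \<and> J a \<subseteq> (\<Union>b\<in>underS r a. F b)"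
    and u0: "\<forall>a\<in>?T. \<forall>x x'. (\<forall>i\<in>J a. x i = x' i) \<longrightarrow> u a x = u a x'"
    and avoid0: "\<forall>a\<in>?T. \<forall>x\<in>P. \<exists>i\<in>F a. x i \<noteq> u a x i"
    by (rule block_decomposition[OF r P])
  note F = bspec[OF F0] and J = bspec[OF J0] and u = bspec[OF u0] and avoid = bspec[OF avoid0]
  have "\<forall>i\<in>?T. \<exists>a\<in>?T. i \<in> F a"
    using un by blast
  then obtain blk where blk: "\<And>i. i \<in> ?T \<Longrightarrow> blk i \<in> ?T" "\<And>i. i \<in> ?T \<Longrightarrow> i \<in> F (blk i)"
    by metis
  have blk_eq: "blk i = a \<and> i \<in> ?T" if "a \<in> ?T" "i \<in> F a" for i a
  proof -
    have "i \<in> ?T"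
      using un that by blast
    then show ?thesis
      using disj that blk[of i] unfolding disjoint_family_on_def by blast
  qed
  let ?t = "\<lambda>x. \<lambda>i\<in>?T. x i \<noteq> u (blk i) x i"
  have "homeomorphic_map (cube ?T) (cube ?T) ?t"
  proof (rule triangular_homeomorphic_map)
    \<comment> \<open>Coordinates are compared through their blocks: \<open>u (blk i)\<close> reads
      only strictly earlier blocks, never other coordinates of the same block.\<close>
    show "wf (inv_image (r - Id) blk)"
      using r by (intro wf_inv_image) (simp add: card_order_on_well_order_on well_order_on_def card_order_on_def)
    fix i assume i: "i \<in> ?T"
    have *: "j \<in> ?T \<and> (j, i) \<in> inv_image (r - Id) blk" if j: "j \<in> J (blk i)" for j
    proof -
      obtain b where b: "b \<in> underS r (blk i)" "j \<in> F b"
        using J[OF blk(1)[OF i]] j by blast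
      then have "b \<in> ?T"
        by (auto simp: underS_def Field_def)
      then show ?thesis
        using blk_eq[OF _ b(2)] b(1) by (auto simp: underS_def)
    qed
    show "finite (J (blk i))" "J (blk i) \<subseteq> ?T"
      using J[OF blk(1)[OF i]] * by auto
    show "(j, i) \<in> inv_image (r - Id) blk" if "j \<in> J (blk i)" for j
      using * that by blast
    show "u (blk i) x i = u (blk i) x' i" if "\<And>j. j \<in> J (blk i) \<Longrightarrow> x j = x' j" for x x'
    proof -
      have "u (blk i) x = u (blk i) x'"
        using u[OF blk(1)[OF i]] that by blast
      then show ?thesis
        by simp
    qed
  qed
  moreover obtain \<Psi> where \<Psi>: "homeomorphic_map (cube ?T) (prod_topology (cube ?T) (cube ?T)) \<Psi>"
    "\<And>x. (\<forall>a\<in>?T. \<exists>i\<in>F a. x i) \<Longrightarrow> snd (\<Psi> x) = (\<lambda>i\<in>?T. False)"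
    using cube_split[OF _ F disj un] r unfolding cinfinite_def by blast
  ultimately have "homeomorphic_map (cube ?T) (prod_topology (cube ?T) (cube ?T)) (\<Psi> \<circ> ?t)"
    by (intro homeomorphic_map_compose)
  moreover have "snd ((\<Psi> \<circ> ?t) x) = (\<lambda>i\<in>?T. False)" if x: "x \<in> P" for x
  proof -
    have "\<exists>i\<in>F a. ?t x i" if a: "a \<in> ?T" for a
    proof -
      obtain i where i: "i \<in> F a" "x i \<noteq> u a x i"
        using avoid[OF a] x by blast
      then have "?t x i"
        using blk_eq[OF a i(1)] by simp
      then show ?thesis
        using i(1) by blast
    qed
    then show ?thesis
      using \<Psi>(2)[of "?t x"] by simp
  qed
  ultimately show thesis
    by (rule that)
qed

subsection \<open>Extending the homeomorphism\<close>

text \<open>Klee's trick: both slices are sheared onto the graph of \<open>f\<close>, by extensions of \<open>f\<close> and of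
  its inverse.\<close>

lemma extend_via_slices:
  fixes T :: "'i set"
  assumes P: "closedin (cube T) P" and K: "closedin (cube T) K"
    and f: "homeomorphic_map (subtopology (cube T) P) (subtopology (cube T) K) f"
    and \<Psi>: "homeomorphic_map (cube T) (prod_topology (cube T) (cube T)) \<Psi>"
      "\<And>x. x \<in> P \<Longrightarrow> snd (\<Psi> x) = (\<lambda>i\<in>T. False)"
    and \<Theta>: "homeomorphic_map (cube T) (prod_topology (cube T) (cube T)) \<Theta>"
      "\<And>x. x \<in> K \<Longrightarrow> snd (\<Theta> x) = (\<lambda>i\<in>T. False)"
  shows "\<exists>g. homeomorphic_map (cube T) (cube T) g \<and> (\<forall>x\<in>P. g x = f x)"
proof -
  let ?X = "cube T" and ?XX = "prod_topology (cube T) (cube T)" and ?o = "\<lambda>i\<in>T. False"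
  have PT: "P \<subseteq> extensional T" "K \<subseteq> extensional T"
    using closedin_subset[OF P] closedin_subset[OF K] by auto
  obtain f' where f': "homeomorphic_maps (subtopology ?X P) (subtopology ?X K) f f'"
    using f homeomorphic_map_maps by blast
  have fK: "f x \<in> K" "f' (f x) = x" if "x \<in> P" for x
    using f' that PT unfolding homeomorphic_maps_def continuous_map_def by auto
  obtain \<Psi>' where "homeomorphic_maps ?X ?XX \<Psi> \<Psi>'"
    using \<Psi>(1) homeomorphic_map_maps by blast
  then have \<Psi>': "continuous_map ?X ?XX \<Psi>" "continuous_map ?XX ?X \<Psi>'"
    "\<And>x. x \<in> extensional T \<Longrightarrow> \<Psi>' (\<Psi> x) = x"
    unfolding homeomorphic_maps_def by auto
  obtain \<Theta>' where \<Theta>'m: "homeomorphic_maps ?X ?XX \<Theta> \<Theta>'"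
    using \<Theta>(1) homeomorphic_map_maps by blast
  then have \<Theta>'h: "homeomorphic_map ?XX ?X \<Theta>'"
    unfolding homeomorphic_maps_map by (elim conjE)
  from \<Theta>'m have \<Theta>': "continuous_map ?X ?XX \<Theta>" "continuous_map ?XX ?X \<Theta>'"
    "\<And>x. x \<in> extensional T \<Longrightarrow> \<Theta>' (\<Theta> x) = x"
    unfolding homeomorphic_maps_def by auto
  have "continuous_map (subtopology ?X P) ?X f" "continuous_map (subtopology ?X K) ?X f'"
    using f' continuous_map_in_subtopology unfolding homeomorphic_maps_def by blast+
  \<comment> \<open>With \<open>p = fst (\<Psi> x)\<close> and
    \<open>q = fst (\<Theta> (f x))\<close>, the extensions \<open>F\<close> and \<open>G\<close>
    compute \<open>q\<close> from \<open>x\<close> and \<open>p\<close> from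
    \<open>f x\<close>.\<close>
  then have Ff: "continuous_map (subtopology ?X P) ?X (fst \<circ> (\<Theta> \<circ> f))"
    and Gf: "continuous_map (subtopology ?X K) ?X (fst \<circ> (\<Psi> \<circ> f'))"
    using \<Psi>'(1) \<Theta>'(1) continuous_map_fst by (auto intro!: continuous_map_compose)
  obtain F where F: "continuous_map ?X ?X F" "\<forall>x\<in>P. F x = (fst \<circ> (\<Theta> \<circ> f)) x"
    by (rule extend_into_cube[OF P Ff])
  obtain G where G: "continuous_map ?X ?X G" "\<forall>x\<in>K. G x = (fst \<circ> (\<Psi> \<circ> f')) x"
    by (rule extend_into_cube[OF K Gf])
  \<comment> \<open>Coordinatewise addition modulo 2. Adding the same point twice cancels, so the
    shears \<open>a\<close> and \<open>b\<close> below are involutions.\<close>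
  define bx where "bx x y = (\<lambda>i\<in>T. x i \<noteq> y i)" for x y :: "'i \<Rightarrow> bool"
  have bx: "bx (bx x y) y = x" "bx ?o x = x" "bx x x = ?o" if "x \<in> extensional T" for x y
    using that by (auto simp: bx_def fun_eq_iff extensional_def)
  have bx_cont: "continuous_map Z ?X (\<lambda>z. bx (p z) (q z))"
    if "continuous_map Z ?X p" "continuous_map Z ?X q" for p q and Z :: "'z topology"
  proof (rule continuous_map_into_cube)
    fix i assume "i \<in> T"
    then show "continuous_map Z (discrete_topology UNIV) (\<lambda>z. bx (p z) (q z) i)"
      using continuous_map_bool_op[OF continuous_map_cube_coord[OF that(1)] continuous_map_cube_coord[OF that(2)],
          of i i "(\<noteq>)"] by (simp add: bx_def)
  qed (simp add: bx_def)
  have slice: "continuous_map ?X ?XX (\<lambda>y. (y, ?o))"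
    by (intro continuous_map_pairedI continuous_map_id[unfolded id_def]) simp
  \<comment> \<open>\<open>F'\<close> and \<open>G'\<close> are \<open>F\<close> and
    \<open>G\<close> read in slice coordinates, so that \<open>F' p = q\<close> and
    \<open>G' q = p\<close> for the pairs coming from \<open>P\<close>.\<close>
  define F' where "F' = F \<circ> \<Psi>' \<circ> (\<lambda>y. (y, ?o))"
  define G' where "G' = G \<circ> \<Theta>' \<circ> (\<lambda>y. (y, ?o))"
  have F'c: "continuous_map ?X ?X F'"
    unfolding F'_def using slice \<Psi>'(2) F(1) by (meson continuous_map_compose)
  have G'c: "continuous_map ?X ?X G'"
    unfolding G'_def using slice \<Theta>'(2) G(1) by (meson continuous_map_compose)
  define a where "a = (\<lambda>xy. (fst xy, bx (snd xy) (F' (fst xy))))"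
  define b where "b = (\<lambda>xy. (bx (fst xy) (G' (snd xy)), snd xy))"
  have a: "homeomorphic_map ?XX ?XX a"
  proof (rule homeomorphic_map_involution)
    show "continuous_map ?XX ?XX a"
      unfolding a_def using continuous_map_compose[OF continuous_map_fst F'c]
      by (intro continuous_map_pairedI bx_cont continuous_map_fst continuous_map_snd) (simp_all add: o_def)
  qed (auto simp: a_def bx(1))
  have b: "homeomorphic_map ?XX ?XX b"
  proof (rule homeomorphic_map_involution)
    show "continuous_map ?XX ?XX b"
      unfolding b_def using continuous_map_compose[OF continuous_map_snd G'c]
      by (intro continuous_map_pairedI bx_cont continuous_map_fst continuous_map_snd) (simp_all add: o_def)
  qed (auto simp: b_def bx(1))
  \<comment> \<open>On \<open>P\<close> the path is \<open>(p, 0)\<close>, then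
    \<open>(p, q)\<close> by \<open>a\<close>, then \<open>(p + p, q) = (0, q)\<close> by
    \<open>b\<close>, then \<open>(q, 0) = \<Theta> (f x)\<close> by the swap.\<close>
  let ?g = "\<Theta>' \<circ> ((\<lambda>(x, y). (y, x)) \<circ> (b \<circ> (a \<circ> \<Psi>)))"
  have "homeomorphic_map ?X ?X ?g"
    by (intro homeomorphic_map_compose[OF homeomorphic_map_compose[OF homeomorphic_map_compose[OF
            homeomorphic_map_compose[OF \<Psi>(1) a] b] homeomorphic_map_swap] \<Theta>'h])
  moreover have "?g x = f x" if x: "x \<in> P" for x
  proof -
    have fx: "f x \<in> K" "f' (f x) = x" "x \<in> extensional T" "f x \<in> extensional T"
      using fK x PT by auto
    have \<Psi>x: "\<Psi> x = (fst (\<Psi> x), ?o)" and \<Theta>x: "\<Theta> (f x) = (fst (\<Theta> (f x)), ?o)"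
      using \<Psi>(2)[OF x] \<Theta>(2)[OF fx(1)] by (simp_all add: prod_eq_iff)
    have ext: "fst (\<Psi> x) \<in> extensional T" "fst (\<Theta> (f x)) \<in> extensional T"
      using \<Psi>'(1) \<Theta>'(1) fx(3,4) by (auto simp: continuous_map_def Pi_iff mem_Times_iff)
    have "F' (fst (\<Psi> x)) = fst (\<Theta> (f x))"
      using bspec[OF F(2) x] \<Psi>'(3)[OF fx(3)] \<Psi>x by (simp add: F'_def)
    moreover have "G' (fst (\<Theta> (f x))) = fst (\<Psi> x)"
      using bspec[OF G(2) fx(1)] \<Theta>'(3)[OF fx(4)] \<Theta>x fx(2) by (simp add: G'_def)
    ultimately have "b (a (\<Psi> x)) = (?o, fst (\<Theta> (f x)))"
      using \<Psi>(2)[OF x] bx(2)[OF ext(2)] bx(3)[OF ext(1)] by (simp add: a_def b_def)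
    then have "?g x = \<Theta>' (fst (\<Theta> (f x)), ?o)"
      by simp
    also have "\<dots> = f x"
      using \<Theta>'(3)[OF fx(4)] \<Theta>x by simp
    finally show ?thesis .
  qed
  ultimately show ?thesis
    by blast
qed

theorem theorem1p2:
  fixes \<tau> :: "'i rel" and P K :: "('i \<Rightarrow> bool) set" and f :: "('i \<Rightarrow> bool) \<Rightarrow> ('i \<Rightarrow> bool)"
  assumes "Cinfinite \<tau>"
    and "closedin (cantor_cube \<tau>) P" and "negligible_in (cantor_cube \<tau>) P"
    and "closedin (cantor_cube \<tau>) K" and "negligible_in (cantor_cube \<tau>) K"
    and "homeomorphic_map (subtopology (cantor_cube \<tau>) P) (subtopology (cantor_cube \<tau>) K) f"
  shows "\<exists>g. homeomorphic_map (cantor_cube \<tau>) (cantor_cube \<tau>) g \<and> (\<forall>x\<in>P. g x = f x)"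
proof -
  note asm = assms(2-6)[unfolded cantor_cube_def]
  obtain \<Psi> where \<Psi>: "homeomorphic_map (cube (Field \<tau>)) (prod_topology (cube (Field \<tau>)) (cube (Field \<tau>))) \<Psi>"
    "\<And>x. x \<in> P \<Longrightarrow> snd (\<Psi> x) = (\<lambda>i\<in>Field \<tau>. False)"
    using negligible_into_slice[OF assms(1) asm(1,2)] by blast
  obtain \<Theta> where \<Theta>: "homeomorphic_map (cube (Field \<tau>)) (prod_topology (cube (Field \<tau>)) (cube (Field \<tau>))) \<Theta>"
    "\<And>x. x \<in> K \<Longrightarrow> snd (\<Theta> x) = (\<lambda>i\<in>Field \<tau>. False)"
    using negligible_into_slice[OF assms(1) asm(3,4)] by blast
  show ?thesis
    unfolding cantor_cube_def by (rule extend_via_slices[OF asm(1,3,5) \<Psi> \<Theta>])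
qed

end
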